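(* Let $(Y,d)$ be a complete locally compact geodesic space satisfying Axiom 1 with respect to a compact metric space $(\overline{Y},\overline{d})$, and put $\partial Y=\overline{Y}\setminus Y$. Let $(Y,d)$ satisfy Axiom 4 and suppose that for every $\zeta\in\partial Y$ and $z_{0}\in Y$ the intersection of horoballs' closures $\bigcap_{r\in\mathbb{R}}\overline{F_{z_{0}}(\zeta,r)}$ consists of a single point. If $f:Y\rightarrow Y$ is a nonexpansive mapping without bounded orbits, then there exists $\xi\in\partial Y$ such that the iterates $f^{n}$ of $f$ converge uniformly on bounded sets of $Y$ to $\xi$.
   Context: Metric spaces are nonempty. A geodesic in $(Y,d)$ is a curve $\sigma:[a,b]\to Y$ with $d(\sigma(t_1),\sigma(t_2))=|t_1-t_2|$ for all $t_1,t_2\in[a,b]$; $Y$ is a geodesic space if every two points are joined by a geodesic. A map $f:Y\to Y$ is nonexpansive if $d(f(x),f(y))\le d(x,y)$ for all $x,y\in Y$. The orbit of $x$ is $\{f^n(x):n=1,2,\ldots\}$; "without bounded orbits" means that no orbit is bounded in $(Y,d)$. Axiom 1: $(Y,d)$ is an open dense subset of a compact metric space $(\overline{Y},\overline{d})$ whose relative topology coincides with the topology of $(Y,d)$; and for any $w\in Y$, if $\{x_n\}$ is a sequence in $Y$ converging (in $\overline{Y}$) to some $\xi\in\partial Y=\overline{Y}\setminus Y$, then $d(x_n,w)\to\infty$. Axiom 4: if $\{x_n\}$ and $\{y_n\}$ are sequences in $Y$, $x_n\to\xi\in\partial Y$, and if $d(x_n,y_n)\le c$ for all $n$ and some constant $c$,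 then $y_n\to\xi$. The big horoball of center $\zeta\in\partial Y$, pole $z_0\in Y$ and radius $r\in\mathbb{R}$ is $$F_{z_0}(\zeta,r)=\{y\in Y:\liminf_{w\to\zeta}\,(d(y,w)-d(w,z_0))\le r\},$$ where $w\in Y$ tends to $\zeta$ in $\overline{Y}$. $\overline{A}$ denotes the closure of $A\subset Y$ in $(\overline{Y},\overline{d})$. Convergence to points of $\partial Y$ is with respect to $\overline{d}$. Uniform convergence on bounded sets to $\xi$ means: for each $d$-bounded $K\subset Y$, $\sup_{y\in K}\overline{d}(f^n(y),\xi)\to 0$. *)

theory Defs
  imports "HOL-Analysis.Analysis"
begin

text \<open>
  Throughout, \<open>Y\<close> is the metric space \<open>(Y, d)\<close> and \<open>Z\<close> is the ambient compact space, the
  closure of \<open>Y\<close> with its own metric. Both are abstract metric spaces on the same type, with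
  the carrier of \<open>Y\<close> a subset of that of \<open>Z\<close>; the two metrics are unrelated except through
  the topology.
\<close>

definition geodesic_in :: "'a metric \<Rightarrow> real \<Rightarrow> real \<Rightarrow> (real \<Rightarrow> 'a) \<Rightarrow> bool" where
  "geodesic_in Y a b \<sigma> \<longleftrightarrow>
     a \<le> b \<and> \<sigma> \<in> {a..b} \<rightarrow> mspace Y \<and>
     (\<forall>s\<in>{a..b}. \<forall>t\<in>{a..b}. mdist Y (\<sigma> s) (\<sigma> t) = \<bar>s - t\<bar>)"

definition geodesic_space :: "'a metric \<Rightarrow> bool" where
  "geodesic_space Y \<longleftrightarrow>
     (\<forall>x\<in>mspace Y. \<forall>y\<in>mspace Y. \<exists>a b \<sigma>. geodesic_in Y a b \<sigma> \<and> \<sigma> a = x \<and> \<sigma> b = y)"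

definition nonexpansive :: "'a metric \<Rightarrow> ('a \<Rightarrow> 'a) \<Rightarrow> bool" where
  "nonexpansive Y f \<longleftrightarrow>
     f \<in> mspace Y \<rightarrow> mspace Y \<and>
     (\<forall>x\<in>mspace Y. \<forall>y\<in>mspace Y. mdist Y (f x) (f y) \<le> mdist Y x y)"

definition bounded_in :: "'a metric \<Rightarrow> 'a set \<Rightarrow> bool" where
  "bounded_in Y S \<longleftrightarrow> Metric_space.mbounded (mspace Y) (mdist Y) S"

definition orbit_of :: "('a \<Rightarrow> 'a) \<Rightarrow> 'a \<Rightarrow> 'a set" where
  "orbit_of f x = {(f ^^ n) x | n. n \<ge> 1}"

definition boundary_in :: "'a metric \<Rightarrow> 'a metric \<Rightarrow> 'a set" where
  "boundary_in Z Y = mspace Z - mspace Y"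

definition axiom1 :: "'a metric \<Rightarrow> 'a metric \<Rightarrow> bool" where
  "axiom1 Z Y \<longleftrightarrow>
     compact_space (mtopology_of Z) \<and>
     openin (mtopology_of Z) (mspace Y) \<and>
     mtopology_of Z closure_of mspace Y = mspace Z \<and>
     subtopology (mtopology_of Z) (mspace Y) = mtopology_of Y \<and>
     (\<forall>w\<in>mspace Y. \<forall>\<xi>\<in>boundary_in Z Y. \<forall>x :: nat \<Rightarrow> 'a.
        range x \<subseteq> mspace Y \<and> limitin (mtopology_of Z) x \<xi> sequentially \<longrightarrow>
        filterlim (\<lambda>n. mdist Y (x n) w) at_top sequentially)"

definition axiom4 :: "'a metric \<Rightarrow> 'a metric \<Rightarrow> bool" where
  "axiom4 Z Y \<longleftrightarrow>
     (\<forall>\<xi>\<in>boundary_in Z Y. \<forall>(x :: nat \<Rightarrow> 'a) y c.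
        range x \<subseteq> mspace Y \<and> range y \<subseteq> mspace Y \<and>
        limitin (mtopology_of Z) x \<xi> sequentially \<and> (\<forall>n. mdist Y (x n) (y n) \<le> c) \<longrightarrow>
        limitin (mtopology_of Z) y \<xi> sequentially)"

text \<open>
  The lower limit is taken in the extended reals, so that it is defined without any
  boundedness assumption; the point \<open>w\<close> ranges over \<open>Y\<close> and tends to \<open>\<zeta>\<close> in the topology
  of \<open>Z\<close>.
\<close>
definition big_horoball :: "'a metric \<Rightarrow> 'a metric \<Rightarrow> 'a \<Rightarrow> 'a \<Rightarrow> real \<Rightarrow> 'a set" where
  "big_horoball Z Y z0 \<zeta> r =
     {y \<in> mspace Y. Liminf (atin_within (mtopology_of Z) \<zeta> (mspace Y))
                      (\<lambda>w. ereal (mdist Y y w - mdist Y w z0)) \<le> ereal r}"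

text \<open>
  The supremum is taken in \<^typ>\<open>ennreal\<close>, where it always exists and is \<open>0\<close> for empty \<open>K\<close>.
\<close>
definition iterates_converge_uniformly_on_bounded ::
    "'a metric \<Rightarrow> 'a metric \<Rightarrow> ('a \<Rightarrow> 'a) \<Rightarrow> 'a \<Rightarrow> bool" where
  "iterates_converge_uniformly_on_bounded Z Y f \<xi> \<longleftrightarrow>
     (\<forall>K. bounded_in Y K \<longrightarrow>
        (\<lambda>n. SUP y\<in>K. ennreal (mdist Z ((f ^^ n) y) \<xi>)) \<longlonglongrightarrow> 0)"

end

theory Submission
  imports Defs
begin

text \<open>
  Write \<open>a n = d (f\<^sup>n x, x)\<close> for a base point \<open>x\<close>. By Axiom 1 a sequence that is bounded in \<open>Y\<close>
  has a subsequence that converges in \<open>Y\<close>, so bounded sets are totally bounded. For such a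
  space a theorem of Calka says that an unbounded orbit of a nonexpansive map has no bounded
  subsequence, hence \<open>a n \<rightarrow> \<infinity>\<close> (\<open>unbounded_orbit_diverges\<close>) and all cluster points of the orbit in
  the compact space \<open>Z\<close> lie on the boundary. It remains to see that there is only one.

  Choose record times \<open>n i\<close>, with \<open>a m \<le> a (n i)\<close> for \<open>m \<le> n i\<close>, such that \<open>w i = f\<^bsup>n i\<^esup> x\<close> converges
  to a boundary point \<open>\<zeta>\<close>. For \<open>T \<ge> 0\<close>, \<open>k\<close> and large \<open>i\<close>, let \<open>z\<close> be the point at distance \<open>T\<close> from \<open>x\<close> on a
  geodesic from \<open>x\<close> to \<open>f\<^bsup>n i - k\<^esup> x\<close>. Then
  \<open>d (f\<^sup>k z, w i) \<le> d (z, f\<^bsup>n i - k\<^esup> x) = a (n i - k) - T \<le> d (w i, x) - T\<close>,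
  so that, as far as \<open>w i\<close> can tell, \<open>f\<^sup>k z\<close> lies in the horoball of center \<open>\<zeta>\<close>, pole \<open>x\<close> and radius
  \<open>- T\<close>. The point \<open>z\<close> depends on \<open>i\<close> and \<open>k\<close>, but it stays in the ball of radius \<open>T\<close>. Replacing it
  by a point of a finite net of that ball costs only a constant in the radius, and it gives, for
  every \<open>r\<close>, a finite set \<open>C\<close> such that for each \<open>k\<close> some \<open>c \<in> C\<close> has \<open>f\<^sup>k c\<close> in the horoball of radius
  \<open>r\<close> (\<open>finite_set_with_iterates_in_horoball\<close>). By Axiom 4, along a subsequence where
  \<open>f\<^sup>k x\<close> tends to \<open>\<eta>\<close> so does \<open>f\<^sup>k c\<close>, for all \<open>c \<in> C\<close>; thus \<open>\<eta>\<close> lies in the closure of every horoball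
  of center \<open>\<zeta>\<close> (\<open>cluster_point_in_horoball_closures\<close>). Therefore \<open>\<eta>\<close> is the single point
  \<open>p\<close> of the intersection of these closures. The limit is \<open>p\<close>, which need not be \<open>\<zeta>\<close>.

  Uniformity is a second use of Axiom 4: a sequence \<open>y j\<close> in a bounded set that violated it would
  have \<open>f\<^bsup>n j\<^esup> (y j)\<close> at bounded distance from \<open>f\<^bsup>n j\<^esup> x \<rightarrow> p\<close>.
\<close>

section \<open>Iterates of nonexpansive maps\<close>

lemma funpow_funpow: "(f ^^ m) ((f ^^ n) x) = (f ^^ (m + n)) x"
  by (simp add: funpow_add)

lemma nonexpansive_funpow:
  assumes "nonexpansive Y f"
  shows "nonexpansive Y (f ^^ n)"
proof (induction n)
  case (Suc n)
  have f: "f a \<in> mspace Y" if "a \<in> mspace Y" for a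
    using assms that by (auto simp: nonexpansive_def)
  have g: "(f ^^ n) a \<in> mspace Y" if "a \<in> mspace Y" for a
    using Suc that by (auto simp: nonexpansive_def)
  have "mdist Y (f ((f ^^ n) a)) (f ((f ^^ n) b)) \<le> mdist Y a b"
    if "a \<in> mspace Y" "b \<in> mspace Y" for a b
  proof -
    have "mdist Y (f ((f ^^ n) a)) (f ((f ^^ n) b)) \<le> mdist Y ((f ^^ n) a) ((f ^^ n) b)"
      using assms g that by (simp add: nonexpansive_def)
    also have "\<dots> \<le> mdist Y a b"
      using Suc that by (simp add: nonexpansive_def)
    finally show ?thesis .
  qed
  then show ?case
    using f g by (auto simp: nonexpansive_def)
qed (simp add: nonexpansive_def)

lemma funpow_in_mspace:
  assumes "nonexpansive Y f" "x \<in> mspace Y"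
  shows "(f ^^ n) x \<in> mspace Y"
  using nonexpansive_funpow[OF assms(1)] assms(2) by (auto simp: nonexpansive_def)

lemma mdist_funpow_le:
  assumes "nonexpansive Y f" "x \<in> mspace Y" "y \<in> mspace Y"
  shows "mdist Y ((f ^^ n) x) ((f ^^ n) y) \<le> mdist Y x y"
  using nonexpansive_funpow[OF assms(1)] assms(2,3) by (auto simp: nonexpansive_def)

lemma mdist_funpow_add_le:
  assumes "nonexpansive Y f" "x \<in> mspace Y" "y \<in> mspace Y"
  shows "mdist Y ((f ^^ (n + k)) x) y \<le> mdist Y ((f ^^ n) x) y + k * mdist Y (f x) x"
proof (induction k)
  case (Suc k)
  have "mdist Y ((f ^^ (n + k)) (f x)) ((f ^^ (n + k)) x) \<le> mdist Y (f x) x"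
    using mdist_funpow_le[OF assms(1)] funpow_in_mspace[OF assms(1), of x 1] assms by simp
  moreover have "mdist Y ((f ^^ (n + k)) (f x)) y
      \<le> mdist Y ((f ^^ (n + k)) (f x)) ((f ^^ (n + k)) x) + mdist Y ((f ^^ (n + k)) x) y"
    using funpow_in_mspace[OF assms(1)] funpow_in_mspace[OF assms(1), of x 1] assms
    by (intro mdist_triangle) auto
  ultimately show ?case
    using Suc by (simp add: funpow_swap1 algebra_simps)
qed simp

text \<open>
  This is Calka's theorem. If the orbit is in the ball of radius \<open>R\<close> around \<open>x\<close> at arbitrarily late
  times, then each point of a finite \<open>1\<close>-net of the orbit points in the ball of radius \<open>R + 1\<close> comes
  back to the ball of radius \<open>R\<close>. An orbit point in the larger ball shadows a point of
  the net within distance \<open>1\<close>, so it comes back to the larger ball in at most \<open>N\<close> steps, with \<open>N\<close>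
  independent of the point. Between returns the orbit can only move away by \<open>N d (f x, x)\<close>, so it
  is bounded.
\<close>

lemma unbounded_orbit_diverges:
  assumes f: "nonexpansive Y f" and x: "x \<in> mspace Y"
    and tb: "\<And>S. bounded_in Y S \<Longrightarrow> Metric_space.mtotally_bounded (mspace Y) (mdist Y) S"
    and unbounded: "\<not> bounded_in Y (orbit_of f x)"
  shows "filterlim (\<lambda>n. mdist Y ((f ^^ n) x) x) at_top sequentially"
proof (rule ccontr)
  interpret Y: Metric_space "mspace Y" "mdist Y" by simp
  let ?a = "\<lambda>n. mdist Y ((f ^^ n) x) x"
  have fx: "(f ^^ n) x \<in> mspace Y" for n
    using funpow_in_mspace[OF f x] .
  assume "\<not> filterlim ?a at_top sequentially"
  then obtain R where "\<not> (\<forall>\<^sub>F n in sequentially. R \<le> ?a n)"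
    by (auto simp: filterlim_at_top)
  then have R: "\<exists>n\<ge>N. ?a n \<le> R" for N
    unfolding eventually_sequentially by (metis linear)
  define S where "S = {(f ^^ k) x | k. ?a k \<le> R + 1}"
  have "bounded_in Y S"
    unfolding bounded_in_def Y.mbounded_def S_def
    by (rule exI[of _ x], rule exI[of _ "R + 1"]) (auto simp: fx x mdist_commute)
  then obtain K where K: "finite K" "K \<subseteq> S" "S \<subseteq> (\<Union>c\<in>K. Y.mball c 1)"
    using tb[of S] zero_less_one unfolding Y.mtotally_bounded_def by blast
  have "\<forall>c\<in>K. \<exists>n\<ge>1. mdist Y ((f ^^ n) c) x \<le> R"
  proof
    fix c assume "c \<in> K"
    then obtain k where k: "c = (f ^^ k) x" using K S_def by auto
    obtain m where "m \<ge> k + 1" "?a m \<le> R" using R by blast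
    then show "\<exists>n\<ge>1. mdist Y ((f ^^ n) c) x \<le> R"
      by (intro exI[of _ "m - k"]) (simp add: k funpow_funpow)
  qed
  then obtain \<tau> where \<tau>: "\<And>c. c \<in> K \<Longrightarrow> \<tau> c \<ge> 1 \<and> mdist Y ((f ^^ \<tau> c) c) x \<le> R"
    by metis
  define N where "N = Max (insert 1 (\<tau> ` K))"
  have return: "\<exists>n\<ge>1. n \<le> N \<and> ?a (k + n) \<le> R + 1" if k: "?a k \<le> R + 1" for k
  proof -
    have "(f ^^ k) x \<in> S" using k S_def by auto
    then obtain c where c: "c \<in> K" "(f ^^ k) x \<in> Y.mball c 1" using K by blast
    have "mdist Y ((f ^^ \<tau> c) ((f ^^ k) x)) x
        \<le> mdist Y ((f ^^ \<tau> c) ((f ^^ k) x)) ((f ^^ \<tau> c) c) + mdist Y ((f ^^ \<tau> c) c) x"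
      using c fx x funpow_in_mspace[OF f] by (intro mdist_triangle) auto
    also have "\<dots> \<le> mdist Y ((f ^^ k) x) c + R"
      using \<tau>[OF c(1)] mdist_funpow_le[OF f, of "(f ^^ k) x" c "\<tau> c"] c fx by auto
    also have "\<dots> \<le> R + 1" using c by (auto simp: mdist_commute)
    finally have "?a (k + \<tau> c) \<le> R + 1" by (simp add: add.commute[of k] funpow_add)
    moreover have "\<tau> c \<le> N" using c K by (auto simp: N_def)
    ultimately show ?thesis using \<tau>[OF c(1)] by blast
  qed
  have start: "?a 0 \<le> R + 1"
  proof -
    obtain n where "?a n \<le> R" using R by blast
    with mdist_nonneg have "0 \<le> R" by (rule order.trans)
    then show ?thesis using x by simp
  qed
  \<comment> \<open>By the uniform return time, every window of \<open>N\<close> consecutive times contains a good one.\<close>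
  have recent: "\<exists>k\<le>m. m < k + N \<and> ?a k \<le> R + 1" for m
  proof (induction m)
    case 0
    have "N \<ge> 1" using K by (auto simp: N_def)
    then show ?case using start by (intro exI[of _ 0]) auto
  next
    case (Suc m)
    then obtain k where k: "k \<le> m" "m < k + N" "?a k \<le> R + 1" by blast
    show ?case
    proof (cases "Suc m < k + N")
      case False
      obtain n where n: "n \<ge> 1" "n \<le> N" "?a (k + n) \<le> R + 1" using return[OF k(3)] by blast
      then show ?thesis using k False by (intro exI[of _ "k + n"]) auto
    qed (use k in \<open>auto intro: le_SucI\<close>)
  qed
  have "?a m \<le> R + 1 + N * mdist Y (f x) x" for m
  proof -
    obtain k where k: "k \<le> m" "m < k + N" "?a k \<le> R + 1" using recent by blast
    have "?a m \<le> ?a k + (m - k) * mdist Y (f x) x"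
      using mdist_funpow_add_le[OF f x x, of k "m - k"] k by simp
    moreover have "(m - k) * mdist Y (f x) x \<le> N * mdist Y (f x) x"
      using k by (intro mult_right_mono) auto
    ultimately show ?thesis using k by linarith
  qed
  then have "orbit_of f x \<subseteq> Y.mcball x (R + 1 + N * mdist Y (f x) x)"
    using x fx by (auto simp: orbit_of_def mdist_commute)
  then show False using unbounded by (auto simp: bounded_in_def Y.mbounded_def)
qed

section \<open>Consequences of the compactification axioms\<close>

lemma axiom1_mspace_subset:
  assumes "axiom1 Z Y"
  shows "mspace Y \<subseteq> mspace Z"
  using assms openin_subset by (fastforce simp: axiom1_def)

lemma axiom1_convergent_subsequence:
  assumes "axiom1 Z Y" "range u \<subseteq> mspace Y"
  obtains l and r :: "nat \<Rightarrow> nat"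
  where "l \<in> mspace Z" "strict_mono r" "limitin (mtopology_of Z) (u \<circ> r) l sequentially"
proof -
  interpret Z: Metric_space "mspace Z" "mdist Z" by simp
  have "compact_space Z.mtopology" "range u \<subseteq> mspace Z"
    using assms axiom1_mspace_subset by (auto simp: axiom1_def mtopology_of_def)
  then show ?thesis
    using that unfolding Z.compact_space_sequentially mtopology_of_def by blast
qed

lemma axiom1_boundary_limit_diverges:
  assumes "axiom1 Z Y" "range u \<subseteq> mspace Y" "w \<in> mspace Y" "\<xi> \<in> boundary_in Z Y"
    "limitin (mtopology_of Z) u \<xi> sequentially"
  shows "filterlim (\<lambda>n. mdist Y (u n) w) at_top sequentially"
  using assms unfolding axiom1_def by blast

lemma axiom1_limitin_Y:
  assumes "axiom1 Z Y" "range u \<subseteq> mspace Y" "l \<in> mspace Y"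
    "limitin (mtopology_of Z) u l sequentially"
  shows "limitin (mtopology_of Y) u l sequentially"
proof -
  have "limitin (subtopology (mtopology_of Z) (mspace Y)) u l sequentially"
    using assms by (auto simp: limitin_subtopology image_subset_iff)
  then show ?thesis using assms by (simp add: axiom1_def)
qed

text \<open>
  A bounded sequence cannot converge to a boundary point, since distances would tend to infinity.
  By compactness of \<open>Z\<close> it has a convergent subsequence, whose limit is then in \<open>Y\<close>, where the
  two topologies agree.
\<close>

lemma axiom1_bounded_imp_mtotally_bounded:
  assumes ax: "axiom1 Z Y" and S: "bounded_in Y S"
  shows "Metric_space.mtotally_bounded (mspace Y) (mdist Y) S"
proof -
  interpret Y: Metric_space "mspace Y" "mdist Y" by simp
  obtain w B where B: "S \<subseteq> Y.mcball w B"
    using S by (auto simp: bounded_in_def Y.mbounded_def)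
  have SY: "S \<subseteq> mspace Y" using B by auto
  have "\<exists>r. strict_mono r \<and> Y.MCauchy (u \<circ> r)" if u: "range u \<subseteq> S" for u :: "nat \<Rightarrow> 'a"
  proof -
    have "range u \<subseteq> mspace Y" using u SY by (rule order_trans)
    from axiom1_convergent_subsequence[OF ax this] obtain l r where r: "l \<in> mspace Z"
      "strict_mono r" "limitin (mtopology_of Z) (u \<circ> r) l sequentially" by blast
    have range: "range (u \<circ> r) \<subseteq> mspace Y" using u SY by auto
    have le: "mdist Y ((u \<circ> r) n) w \<le> B" for n
    proof -
      have "u (r n) \<in> Y.mcball w B" using u B by blast
      then show ?thesis by (simp add: mdist_commute)
    qed
    have w: "w \<in> mspace Y" using u B by (auto simp: image_subset_iff subset_iff)
    have "l \<in> mspace Y"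
    proof (rule ccontr)
      assume "l \<notin> mspace Y"
      then have "filterlim (\<lambda>n. mdist Y ((u \<circ> r) n) w) at_top sequentially"
        using axiom1_boundary_limit_diverges[OF ax range w _ r(3)] r(1)
        by (simp add: boundary_in_def)
      then have "\<forall>\<^sub>F n in sequentially. B < mdist Y ((u \<circ> r) n) w"
        by (simp add: filterlim_at_top_dense)
      then show False using le by (simp add: not_less[THEN iffD2])
    qed
    then have "limitin Y.mtopology (u \<circ> r) l sequentially"
      using axiom1_limitin_Y[OF ax range] r by (simp add: mtopology_of_def)
    then show ?thesis using Y.convergent_imp_MCauchy range r by blast
  qed
  then show ?thesis using SY by (simp add: Y.mtotally_bounded_sequentially)
qed

lemma axiom1_divergent_limit_in_boundary:
  assumes ax: "axiom1 Z Y" and u: "range u \<subseteq> mspace Y" and w: "w \<in> mspace Y"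
    and lim: "limitin (mtopology_of Z) u l sequentially"
    and div: "filterlim (\<lambda>n. mdist Y (u n) w) at_top sequentially"
  shows "l \<in> boundary_in Z Y"
proof (rule ccontr)
  interpret Y: Metric_space "mspace Y" "mdist Y" by simp
  assume "l \<notin> boundary_in Z Y"
  then have l: "l \<in> mspace Y"
    using limitin_topspace[OF lim] by (simp add: boundary_in_def)
  have "\<forall>\<^sub>F n in sequentially. mdist Y (u n) l < 1"
    using axiom1_limitin_Y[OF ax u l lim]
    by (auto simp: mtopology_of_def Y.limitin_metric eventually_conj_iff)
  moreover have "\<forall>\<^sub>F n in sequentially. 1 + mdist Y l w < mdist Y (u n) w"
    using div by (simp add: filterlim_at_top_dense)
  ultimately have "\<forall>\<^sub>F n in sequentially. False"
  proof eventually_elim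
    case (elim n)
    then show False using mdist_triangle[of "u n" Y l w] u l w by force
  qed
  then show False by simp
qed

lemma axiom4_limitin:
  assumes "axiom4 Z Y" "\<xi> \<in> boundary_in Z Y" "limitin (mtopology_of Z) u \<xi> sequentially"
    and "\<And>n. u n \<in> mspace Y" "\<And>n. v n \<in> mspace Y" "\<And>n. mdist Y (u n) (v n) \<le> c"
  shows "limitin (mtopology_of Z) v \<xi> sequentially"
proof -
  have "range u \<subseteq> mspace Y" "range v \<subseteq> mspace Y" using assms(4,5) by auto
  then show ?thesis
    using assms(1)[unfolded axiom4_def, rule_format, of \<xi> u v c] assms(2,3,6) by blast
qed

section \<open>Record times and horoballs\<close>

text \<open>
  The first time at which a sequence exceeds its maximum over \<open>{..N}\<close> is a record time.
\<close>

lemma frequently_record: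
  fixes a :: "nat \<Rightarrow> real"
  assumes "filterlim a at_top sequentially"
  shows "\<exists>\<^sub>F n in sequentially. \<forall>m\<le>n. a m \<le> a n"
  unfolding frequently_sequentially
proof
  fix N
  define M where "M = Max (a ` {..N})"
  have M: "a m \<le> M" if "m \<le> N" for m using that by (simp add: M_def)
  have "\<exists>n. M < a n"
    using assms unfolding filterlim_at_top_dense
    using eventually_happens'[OF sequentially_bot] by blast
  define n where "n = (LEAST n. M < a n)"
  have n: "M < a n" unfolding n_def using \<open>\<exists>n. M < a n\<close> by (rule LeastI_ex)
  have "a m \<le> M" if "m < n" for m using not_less_Least[OF that[unfolded n_def]] by simp
  then have "\<forall>m\<le>n. a m \<le> a n" using n by (force simp: le_less)
  moreover have "N \<le> n" using M[of n] n by linarith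
  ultimately show "\<exists>n\<ge>N. \<forall>m\<le>n. a m \<le> a n" by blast
qed

lemma Liminf_le_of_frequently:
  fixes g :: "'b \<Rightarrow> 'c :: complete_linorder"
  assumes "\<exists>\<^sub>F w in F. g w \<le> C"
  shows "Liminf F g \<le> C"
proof (rule ccontr)
  assume "\<not> Liminf F g \<le> C"
  then have "\<forall>\<^sub>F w in F. C < g w" by (intro less_LiminfD) simp
  then show False using assms by (simp add: frequently_def not_le)
qed

lemma geodesic_space_point_at_distance:
  assumes "geodesic_space Y" "x \<in> mspace Y" "y \<in> mspace Y" "0 \<le> T" "T \<le> mdist Y x y"
  obtains z where "z \<in> mspace Y" "mdist Y x z = T" "mdist Y z y = mdist Y x y - T"
proof -
  obtain a b \<sigma> where \<sigma>: "geodesic_in Y a b \<sigma>" "\<sigma> a = x" "\<sigma> b = y"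
    using assms by (meson geodesic_space_def)
  then have ab: "a \<le> b" and
    d: "\<And>s t. s \<in> {a..b} \<Longrightarrow> t \<in> {a..b} \<Longrightarrow> mdist Y (\<sigma> s) (\<sigma> t) = \<bar>s - t\<bar>"
    and im: "\<And>s. s \<in> {a..b} \<Longrightarrow> \<sigma> s \<in> mspace Y"
    by (auto simp: geodesic_in_def)
  have len: "mdist Y x y = b - a" using d[of a b] ab \<sigma> by simp
  show ?thesis
  proof (rule that[of "\<sigma> (a + T)"])
    show "\<sigma> (a + T) \<in> mspace Y" using im len assms by simp
    show "mdist Y x (\<sigma> (a + T)) = T" using d[of a "a + T"] len assms ab \<sigma> by simp
    show "mdist Y (\<sigma> (a + T)) y = mdist Y x y - T" using d[of "a + T" b] len assms ab \<sigma> by simp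
  qed
qed

text \<open>
  Membership in a horoball is defined by a lower limit, so it can be tested along any one sequence
  that tends to the center, and there infinitely many indices suffice.
\<close>

lemma in_big_horoball_of_frequently:
  assumes "y \<in> mspace Y" "\<zeta> \<in> boundary_in Z Y" "range w \<subseteq> mspace Y"
    and lim: "limitin (mtopology_of Z) w \<zeta> sequentially"
    and freq: "\<exists>\<^sub>F i in sequentially. mdist Y y (w i) - mdist Y (w i) z0 \<le> r"
  shows "y \<in> big_horoball Z Y z0 \<zeta> r"
proof -
  let ?F = "atin_within (mtopology_of Z) \<zeta> (mspace Y)"
  have w: "filterlim w ?F sequentially"
    unfolding filterlim_iff eventually_atin_within
  proof (intro allI impI)
    fix P
    assume P: "\<zeta> \<notin> topspace (mtopology_of Z) \<or>
      (\<exists>T. openin (mtopology_of Z) T \<and> \<zeta> \<in> T \<and> (\<forall>x\<in>T. x \<in> mspace Y \<and> x \<noteq> \<zeta> \<longrightarrow> P x))"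
    then obtain T where T: "openin (mtopology_of Z) T" "\<zeta> \<in> T"
      "\<forall>x\<in>T. x \<in> mspace Y \<and> x \<noteq> \<zeta> \<longrightarrow> P x"
      using assms(2) by (auto simp: boundary_in_def)
    have "w i \<in> mspace Y \<and> w i \<noteq> \<zeta>" for i
      using assms(2,3) by (auto simp: boundary_in_def)
    then show "\<forall>\<^sub>F i in sequentially. P (w i)"
      using limitinD[OF lim T(1,2)] T(3) by (auto elim: eventually_mono)
  qed
  have "\<exists>\<^sub>F v in ?F. ereal (mdist Y y v - mdist Y v z0) \<le> ereal r"
    using freq w unfolding frequently_def filterlim_iff by fastforce
  then show ?thesis
    using assms(1) by (simp add: big_horoball_def Liminf_le_of_frequently)
qed

text \<open>
  The bound on \<open>f\<^sup>k z\<close> from the record times holds for points \<open>z\<close> of the ball of radius \<open>T\<close> that vary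
  with \<open>k\<close> and with the record time. A finite net handles both dependencies: for
  fixed \<open>k\<close>, one point of the net is near \<open>z\<close> for infinitely many record times, and that is all the
  lower limit asks for. The set \<open>C\<close> does not depend on \<open>k\<close>.
\<close>

lemma finite_set_with_iterates_in_horoball:
  assumes ax: "axiom1 Z Y" and geo: "geodesic_space Y" and f: "nonexpansive Y f"
    and x: "x \<in> mspace Y"
    and div: "filterlim (\<lambda>n. mdist Y ((f ^^ n) x) x) at_top sequentially"
  obtains \<zeta> where "\<zeta> \<in> boundary_in Z Y"
    "\<And>r. \<exists>C. finite C \<and> C \<subseteq> mspace Y \<and> (\<forall>k. \<exists>c\<in>C. (f ^^ k) c \<in> big_horoball Z Y x \<zeta> r)"
proof -
  interpret Y: Metric_space "mspace Y" "mdist Y" by simp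
  let ?a = "\<lambda>n. mdist Y ((f ^^ n) x) x"
  have fx: "(f ^^ n) x \<in> mspace Y" for n
    using funpow_in_mspace[OF f x] .
  have "infinite {n. \<forall>m\<le>n. ?a m \<le> ?a n}"
    using frequently_record[OF div] by (simp add: frequently_cofinite cofinite_eq_sequentially[symmetric])
  then obtain \<rho> :: "nat \<Rightarrow> nat"
    where \<rho>: "strict_mono \<rho>" "\<And>i. \<forall>m\<le>\<rho> i. ?a m \<le> ?a (\<rho> i)"
    using infinite_enumerate[of "{n. \<forall>m\<le>n. ?a m \<le> ?a n}"] by auto
  have "range (\<lambda>i. (f ^^ \<rho> i) x) \<subseteq> mspace Y" using fx by auto
  from axiom1_convergent_subsequence[OF ax this] obtain \<zeta> s where s: "strict_mono s"
    "limitin (mtopology_of Z) ((\<lambda>i. (f ^^ \<rho> i) x) \<circ> s) \<zeta> sequentially" by blast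
  define \<nu> where "\<nu> = \<rho> \<circ> s"
  have \<nu>: "strict_mono \<nu>" "\<And>i m. m \<le> \<nu> i \<Longrightarrow> ?a m \<le> ?a (\<nu> i)"
    using \<rho> s(1) by (auto simp: \<nu>_def strict_mono_o)
  define w where "w i = (f ^^ \<nu> i) x" for i
  have w: "range w \<subseteq> mspace Y" using fx by (auto simp: w_def)
  have lim: "limitin (mtopology_of Z) w \<zeta> sequentially"
    using s(2) by (simp add: w_def[abs_def] \<nu>_def o_def)
  have "filterlim (\<lambda>i. mdist Y (w i) x) at_top sequentially"
    unfolding w_def using filterlim_compose[OF div filterlim_subseq[OF \<nu>(1)]] .
  then have \<zeta>: "\<zeta> \<in> boundary_in Z Y"
    using axiom1_divergent_limit_in_boundary[OF ax w x lim] by blast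
  moreover have "\<exists>C. finite C \<and> C \<subseteq> mspace Y \<and>
      (\<forall>k. \<exists>c\<in>C. (f ^^ k) c \<in> big_horoball Z Y x \<zeta> r)" for r
  proof -
    \<comment> \<open>Passing from \<open>z\<close> to the \<open>1\<close>-net turns the radius \<open>- T\<close> into \<open>1 - T \<le> r\<close>.\<close>
    define T where "T = max 0 (1 - r)"
    have "bounded_in Y (Y.mcball x T)" by (unfold bounded_in_def) (rule Y.mbounded_mcball)
    then obtain C where C: "finite C" "C \<subseteq> Y.mcball x T"
        "Y.mcball x T \<subseteq> (\<Union>c\<in>C. Y.mball c 1)"
      using axiom1_bounded_imp_mtotally_bounded[OF ax, of "Y.mcball x T"] zero_less_one
      unfolding Y.mtotally_bounded_def by blast
    have CY: "C \<subseteq> mspace Y" using C by auto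
    have "\<exists>c\<in>C. (f ^^ k) c \<in> big_horoball Z Y x \<zeta> r" for k
    proof -
      \<comment> \<open>The geodesic to \<open>f\<^bsup>n i - k\<^esup> x\<close> must be long enough to contain a point at distance \<open>T\<close>.\<close>
      have "\<forall>\<^sub>F n in sequentially. T \<le> ?a (n - k)"
        using filterlim_compose[OF div filterlim_minus_const_nat_at_top[of k]]
        by (simp add: filterlim_at_top)
      then have "\<forall>\<^sub>F n in sequentially. k \<le> n \<and> T \<le> ?a (n - k)"
        using eventually_ge_at_top[of k] by eventually_elim simp
      then have "\<forall>\<^sub>F i in sequentially. k \<le> \<nu> i \<and> T \<le> ?a (\<nu> i - k)"
        using eventually_subseq[OF \<nu>(1)] by blast
      then have "\<forall>\<^sub>F i in sequentially. \<exists>c\<in>C. mdist Y ((f ^^ k) c) (w i) - mdist Y (w i) x \<le> r"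
      proof eventually_elim
        case (elim i)
        define v where "v = (f ^^ (\<nu> i - k)) x"
        have v: "v \<in> mspace Y" "w i = (f ^^ k) v"
          using fx elim by (auto simp: v_def w_def funpow_funpow)
        obtain z where z: "z \<in> mspace Y" "mdist Y x z = T" "mdist Y z v = mdist Y x v - T"
          using geodesic_space_point_at_distance[OF geo x v(1), of T] elim
          by (auto simp: T_def v_def mdist_commute)
        then obtain c where c: "c \<in> C" "mdist Y c z < 1" using C(3) x by force
        have cY: "c \<in> mspace Y" using c CY by blast
        have "mdist Y ((f ^^ k) c) (w i) \<le> mdist Y c v"
          unfolding v(2) by (rule mdist_funpow_le[OF f cY v(1)])
        also have "\<dots> \<le> mdist Y c z + mdist Y z v"
          using cY z v by (intro mdist_triangle)
        also have "\<dots> \<le> 1 + (mdist Y v x - T)"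
          using c z by (simp add: mdist_commute)
        also have "mdist Y v x \<le> mdist Y (w i) x"
          unfolding v_def w_def by (rule \<nu>(2)) simp
        finally show ?case using c(1) by (intro bexI[of _ c]) (auto simp: T_def)
      qed
      then have "\<exists>\<^sub>F i in sequentially. \<exists>c\<in>C. mdist Y ((f ^^ k) c) (w i) - mdist Y (w i) x \<le> r"
        by (rule eventually_frequently[OF sequentially_bot])
      then have "\<exists>c\<in>C. \<exists>\<^sub>F i in sequentially. mdist Y ((f ^^ k) c) (w i) - mdist Y (w i) x \<le> r"
        by (rule frequently_bex_finite[OF C(1)])
      then obtain c where "c \<in> C"
        "\<exists>\<^sub>F i in sequentially. mdist Y ((f ^^ k) c) (w i) - mdist Y (w i) x \<le> r"
        by blast
      then show ?thesis
        using in_big_horoball_of_frequently[OF _ \<zeta> w lim] funpow_in_mspace[OF f] CY by blast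
    qed
    then show ?thesis using C(1) CY by blast
  qed
  ultimately show ?thesis using that by blast
qed

section \<open>Cluster points of orbits\<close>

text \<open>
  The point \<open>c\<close> with \<open>f\<^sup>k c \<in> F\<close> may change with \<open>k\<close>. Since \<open>C\<close> is finite, Axiom 4 puts the iterates of
  all its points into a given neighborhood of \<open>\<eta>\<close> at the same time.
\<close>

lemma cluster_point_in_horoball_closures:
  assumes ax4: "axiom4 Z Y" and f: "nonexpansive Y f" and x: "x \<in> mspace Y"
    and C: "finite C" "C \<subseteq> mspace Y" "\<And>k. \<exists>c\<in>C. (f ^^ k) c \<in> F"
    and \<eta>: "\<eta> \<in> boundary_in Z Y"
    and lim: "limitin (mtopology_of Z) (\<lambda>j. (f ^^ \<kappa> j) x) \<eta> sequentially"
  shows "\<eta> \<in> mtopology_of Z closure_of F"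
  unfolding in_closure_of
proof (intro conjI allI impI)
  show "\<eta> \<in> topspace (mtopology_of Z)" using \<eta> by (simp add: boundary_in_def)
  fix U assume U: "\<eta> \<in> U \<and> openin (mtopology_of Z) U"
  have "\<forall>\<^sub>F j in sequentially. (f ^^ \<kappa> j) c \<in> U" if c: "c \<in> C" for c
  proof -
    have cY: "c \<in> mspace Y" using c C by blast
    have "limitin (mtopology_of Z) (\<lambda>j. (f ^^ \<kappa> j) c) \<eta> sequentially"
      by (rule axiom4_limitin[OF ax4 \<eta> lim]) (use f x cY in \<open>auto intro: mdist_funpow_le funpow_in_mspace\<close>)
    then show ?thesis using U limitinD by fast
  qed
  then have "\<forall>\<^sub>F j in sequentially. \<forall>c\<in>C. (f ^^ \<kappa> j) c \<in> U"
    using C(1) by (simp add: eventually_ball_finite_distrib)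
  then obtain j where "\<forall>c\<in>C. (f ^^ \<kappa> j) c \<in> U"
    using eventually_happens'[OF sequentially_bot] by blast
  then show "\<exists>y. y \<in> F \<and> y \<in> U" using C(3)[of "\<kappa> j"] by blast
qed

text \<open>
  If convergence were not uniform on \<open>K\<close>, there would be late iterates of points of \<open>K\<close> that stay away
  from \<open>p\<close>. By compactness the same iterates of \<open>x\<close> converge along a subsequence, necessarily to \<open>p\<close>,
  and Axiom 4 transfers this to the points of \<open>K\<close>.
\<close>

lemma iterates_converge_uniformly_of_unique_cluster_point:
  assumes ax: "axiom1 Z Y" and ax4: "axiom4 Z Y" and f: "nonexpansive Y f"
    and x: "x \<in> mspace Y" and p: "p \<in> boundary_in Z Y"
    and unique: "\<And>\<kappa> \<eta>. strict_mono \<kappa> \<Longrightarrow>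
      limitin (mtopology_of Z) (\<lambda>j. (f ^^ \<kappa> j) x) \<eta> sequentially \<Longrightarrow> \<eta> = p"
  shows "iterates_converge_uniformly_on_bounded Z Y f p"
  unfolding iterates_converge_uniformly_on_bounded_def
proof (intro allI impI)
  interpret Y: Metric_space "mspace Y" "mdist Y" by simp
  interpret Z: Metric_space "mspace Z" "mdist Z" by simp
  fix K assume "bounded_in Y K"
  then obtain v B where K: "K \<subseteq> Y.mcball v B" by (auto simp: bounded_in_def Y.mbounded_def)
  have uniform: "\<forall>\<^sub>F n in sequentially. \<forall>y\<in>K. mdist Z ((f ^^ n) y) p \<le> e" if e: "e > 0" for e
  proof (rule ccontr)
    assume "\<not> ?thesis"
    then have "infinite {n. \<exists>y\<in>K. e < mdist Z ((f ^^ n) y) p}"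
      by (simp add: not_eventually frequently_cofinite not_le cofinite_eq_sequentially[symmetric])
    then obtain \<kappa> :: "nat \<Rightarrow> nat"
      where \<kappa>: "strict_mono \<kappa>" "\<And>n. \<exists>y\<in>K. e < mdist Z ((f ^^ \<kappa> n) y) p"
      using infinite_enumerate[of "{n. \<exists>y\<in>K. e < mdist Z ((f ^^ n) y) p}"] by auto
    then obtain y where y: "\<And>n. y n \<in> K" "\<And>n. e < mdist Z ((f ^^ \<kappa> n) (y n)) p"
      by metis
    have "range (\<lambda>n. (f ^^ \<kappa> n) x) \<subseteq> mspace Y" using funpow_in_mspace[OF f x] by auto
    from axiom1_convergent_subsequence[OF ax this] obtain \<eta> s where s: "strict_mono s"
      "limitin (mtopology_of Z) ((\<lambda>n. (f ^^ \<kappa> n) x) \<circ> s) \<eta> sequentially" by blast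
    have lim: "limitin (mtopology_of Z) (\<lambda>n. (f ^^ \<kappa> (s n)) x) p sequentially"
      using unique[of "\<kappa> \<circ> s" \<eta>] s strict_mono_o[OF \<kappa>(1) s(1)] by (simp add: o_def)
    have yY: "y n \<in> mspace Y" for n using subsetD[OF K y(1)] by simp
    have vY: "v \<in> mspace Y" using subsetD[OF K y(1)] by simp
    have "mdist Y ((f ^^ \<kappa> (s n)) x) ((f ^^ \<kappa> (s n)) (y (s n))) \<le> mdist Y x v + B" for n
    proof -
      have "mdist Y ((f ^^ \<kappa> (s n)) x) ((f ^^ \<kappa> (s n)) (y (s n))) \<le> mdist Y x (y (s n))"
        by (rule mdist_funpow_le[OF f x yY])
      also have "\<dots> \<le> mdist Y x v + mdist Y v (y (s n))"
        by (rule mdist_triangle[OF x vY yY])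
      also have "mdist Y v (y (s n)) \<le> B" using subsetD[OF K y(1)] by simp
      finally show ?thesis by simp
    qed
    then have "limitin (mtopology_of Z) (\<lambda>n. (f ^^ \<kappa> (s n)) (y (s n))) p sequentially"
      by (rule axiom4_limitin[OF ax4 p lim funpow_in_mspace[OF f x] funpow_in_mspace[OF f yY]])
    then have "\<forall>\<^sub>F n in sequentially. mdist Z ((f ^^ \<kappa> (s n)) (y (s n))) p < e"
      using e by (auto simp: mtopology_of_def Z.limitin_metric eventually_conj_iff)
    then have "\<forall>\<^sub>F n in sequentially. False"
      by eventually_elim (use y(2) less_asym in blast)
    then show False by simp
  qed
  show "(\<lambda>n. SUP y\<in>K. ennreal (mdist Z ((f ^^ n) y) p)) \<longlonglongrightarrow> 0"
  proof (rule order_tendstoI)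
    fix a :: ennreal assume "0 < a"
    then obtain b where b: "0 < b" "b < a" using dense by blast
    then obtain e where e: "b = ennreal e" "e > 0"
      by (cases b) auto
    show "\<forall>\<^sub>F n in sequentially. (SUP y\<in>K. ennreal (mdist Z ((f ^^ n) y) p)) < a"
      using uniform[OF e(2)]
    proof eventually_elim
      case (elim n)
      then have "(SUP y\<in>K. ennreal (mdist Z ((f ^^ n) y) p)) \<le> b"
        unfolding e(1) by (intro SUP_least ennreal_leI) auto
      then show ?case using b(2) by (rule le_less_trans)
    qed
  qed simp
qed

section \<open>Convergence of the iterates\<close>

theorem theorem3p2:
  fixes Y Z :: "'a metric" and f :: "'a \<Rightarrow> 'a"
  assumes "mspace Y \<noteq> {}"
    and "mcomplete_of Y"
    and "locally_compact_space (mtopology_of Y)"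
    and "geodesic_space Y"
    and "axiom1 Z Y"
    and "axiom4 Z Y"
    and "\<And>\<zeta> z0. \<zeta> \<in> boundary_in Z Y \<Longrightarrow> z0 \<in> mspace Y \<Longrightarrow>
           \<exists>p. (\<Inter>r::real. mtopology_of Z closure_of big_horoball Z Y z0 \<zeta> r) = {p}"
    and "nonexpansive Y f"
    and "\<And>x. x \<in> mspace Y \<Longrightarrow> \<not> bounded_in Y (orbit_of f x)"
  shows "\<exists>\<xi>\<in>boundary_in Z Y. iterates_converge_uniformly_on_bounded Z Y f \<xi>"
proof -
  note geo = assms(4) and ax1 = assms(5) and ax4 = assms(6) and f = assms(8)
  obtain x where x: "x \<in> mspace Y" using assms(1) by blast
  have div: "filterlim (\<lambda>n. mdist Y ((f ^^ n) x) x) at_top sequentially"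
    using unbounded_orbit_diverges[OF f x] axiom1_bounded_imp_mtotally_bounded[OF ax1]
      assms(9)[OF x] by blast
  obtain \<zeta> where \<zeta>: "\<zeta> \<in> boundary_in Z Y" and
    C: "\<And>r. \<exists>C. finite C \<and> C \<subseteq> mspace Y \<and> (\<forall>k. \<exists>c\<in>C. (f ^^ k) c \<in> big_horoball Z Y x \<zeta> r)"
    by (rule finite_set_with_iterates_in_horoball[OF ax1 geo f x div]) blast
  obtain p where p: "(\<Inter>r::real. mtopology_of Z closure_of big_horoball Z Y x \<zeta> r) = {p}"
    using assms(7)[OF \<zeta> x] by blast
  have cluster: "\<eta> \<in> boundary_in Z Y \<and> \<eta> = p"
    if \<kappa>: "strict_mono \<kappa>"
      and lim: "limitin (mtopology_of Z) (\<lambda>j. (f ^^ \<kappa> j) x) \<eta> sequentially" for \<kappa> \<eta>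
  proof -
    have "\<eta> \<in> boundary_in Z Y"
    proof (rule axiom1_divergent_limit_in_boundary[OF ax1 _ x lim])
      show "range (\<lambda>j. (f ^^ \<kappa> j) x) \<subseteq> mspace Y" using funpow_in_mspace[OF f x] by auto
      show "filterlim (\<lambda>j. mdist Y ((f ^^ \<kappa> j) x) x) at_top sequentially"
        using filterlim_compose[OF div filterlim_subseq[OF \<kappa>]] .
    qed
    moreover from this have "\<eta> \<in> mtopology_of Z closure_of big_horoball Z Y x \<zeta> r" for r
    proof -
      obtain D where D: "finite D" "D \<subseteq> mspace Y"
        "\<And>k. \<exists>c\<in>D. (f ^^ k) c \<in> big_horoball Z Y x \<zeta> r" using C[of r] by blast
      show ?thesis
        using cluster_point_in_horoball_closures[OF ax4 f x D _ lim] \<open>\<eta> \<in> boundary_in Z Y\<close> .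
    qed
    ultimately show ?thesis using p by blast
  qed
  have "range (\<lambda>n. (f ^^ n) x) \<subseteq> mspace Y" using funpow_in_mspace[OF f x] by auto
  from axiom1_convergent_subsequence[OF ax1 this] obtain \<eta> s where
    "strict_mono s" "limitin (mtopology_of Z) ((\<lambda>n. (f ^^ n) x) \<circ> s) \<eta> sequentially" by blast
  then have "p \<in> boundary_in Z Y" using cluster[of s \<eta>] by (auto simp: o_def)
  then show ?thesis
    using iterates_converge_uniformly_of_unique_cluster_point[OF ax1 ax4 f x] cluster by blast
qed

end
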